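(* Extension Dominating Set can be solved in polynomial time on split graphs.
   Context: For a graph $G=(V,E)$, $D\subseteq V$ is a dominating set if every vertex is in $D$ or has a neighbor in $D$; it is minimal if no proper subset is a dominating set. Extension Dominating Set: given a graph $G=(V,E)$ and $U\subseteq V$, decide whether there is a minimal dominating set $D$ with $U\subseteq D$. A split graph is a graph whose vertex set partitions into a clique and an independent set. *)

theory Defs
  imports "HOL-Computational_Algebra.Polynomial"
begin

subsection \<open>Graphs and dominating sets\<close>

definition simple_graph :: "'a set \<Rightarrow> 'a set set \<Rightarrow> bool" where
  "simple_graph V E \<longleftrightarrow> finite V \<and> (\<forall>e\<in>E. e \<subseteq> V \<and> card e = 2)"

definition clique :: "'a set set \<Rightarrow> 'a set \<Rightarrow> bool" where
  "clique E C \<longleftrightarrow> (\<forall>u\<in>C. \<forall>v\<in>C. u \<noteq> v \<longrightarrow> {u, v} \<in> E)"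

definition independent_set :: "'a set set \<Rightarrow> 'a set \<Rightarrow> bool" where
  "independent_set E I \<longleftrightarrow> (\<forall>u\<in>I. \<forall>v\<in>I. {u, v} \<notin> E)"

definition split_graph :: "'a set \<Rightarrow> 'a set set \<Rightarrow> bool" where
  "split_graph V E \<longleftrightarrow> simple_graph V E \<and>
     (\<exists>C I. C \<union> I = V \<and> C \<inter> I = {} \<and> clique E C \<and> independent_set E I)"

definition dominating_set :: "'a set \<Rightarrow> 'a set set \<Rightarrow> 'a set \<Rightarrow> bool" where
  "dominating_set V E D \<longleftrightarrow> D \<subseteq> V \<and> (\<forall>v\<in>V. v \<in> D \<or> (\<exists>u\<in>D. {u, v} \<in> E))"

definition minimal_dominating_set :: "'a set \<Rightarrow> 'a set set \<Rightarrow> 'a set \<Rightarrow> bool" where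
  "minimal_dominating_set V E D \<longleftrightarrow>
     dominating_set V E D \<and> (\<forall>D'. D' \<subset> D \<longrightarrow> \<not> dominating_set V E D')"

definition extension_dominating_set :: "'a set \<Rightarrow> 'a set set \<Rightarrow> 'a set \<Rightarrow> bool" where
  "extension_dominating_set V E U \<longleftrightarrow> (\<exists>D. minimal_dominating_set V E D \<and> U \<subseteq> D)"


subsection \<open>Random access machines\<close>

text \<open>
  A random access machine has registers \<open>R\<close>, addressed directly, and a memory \<open>M\<close>, addressed
  indirectly through registers; both hold natural numbers. Every instruction costs one step.
  Addition and (truncated) subtraction are the only arithmetic operations: without
  multiplication, the numbers produced in \<open>t\<close> steps are at most \<open>O(t)\<close> bits longer than the
  initial ones, so polynomial time on this machine with unit costs coincides with polynomial
  time on Turing machines.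
\<close>

datatype instr =
    Const nat nat      \<comment> \<open>\<open>R\<^sub>i := c\<close>\<close>
  | Add nat nat nat    \<comment> \<open>\<open>R\<^sub>i := R\<^sub>j + R\<^sub>k\<close>\<close>
  | Sub nat nat nat    \<comment> \<open>\<open>R\<^sub>i := R\<^sub>j - R\<^sub>k\<close>, truncated at \<open>0\<close>\<close>
  | Load nat nat       \<comment> \<open>\<open>R\<^sub>i := M[R\<^sub>j]\<close>\<close>
  | Store nat nat      \<comment> \<open>\<open>M[R\<^sub>i] := R\<^sub>j\<close>\<close>
  | JumpZero nat nat   \<comment> \<open>if \<open>R\<^sub>i = 0\<close> then go to instruction \<open>l\<close>\<close>

type_synonym program = "instr list"

type_synonym config = "nat \<times> (nat \<Rightarrow> nat) \<times> (nat \<Rightarrow> nat)"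

fun exec_instr :: "instr \<Rightarrow> config \<Rightarrow> config" where
  "exec_instr (Const i c) (pc, R, M) = (Suc pc, R(i := c), M)"
| "exec_instr (Add i j k) (pc, R, M) = (Suc pc, R(i := R j + R k), M)"
| "exec_instr (Sub i j k) (pc, R, M) = (Suc pc, R(i := R j - R k), M)"
| "exec_instr (Load i j) (pc, R, M) = (Suc pc, R(i := M (R j)), M)"
| "exec_instr (Store i j) (pc, R, M) = (Suc pc, R, M(R i := R j))"
| "exec_instr (JumpZero i l) (pc, R, M) = ((if R i = 0 then l else Suc pc), R, M)"

definition halted :: "program \<Rightarrow> config \<Rightarrow> bool" where
  "halted P c \<longleftrightarrow> length P \<le> fst c"

definition step :: "program \<Rightarrow> config \<Rightarrow> config" where
  "step P c = (if halted P c then c else exec_instr (P ! fst c) c)"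

text \<open>The length of the input word is in register \<open>0\<close>, its \<open>i\<close>-th letter in memory cell \<open>i\<close>.\<close>

definition initial_config :: "bool list \<Rightarrow> config" where
  "initial_config w =
     (0, (\<lambda>_. 0)(0 := length w), (\<lambda>i. if i < length w then of_bool (w ! i) else 0))"

text \<open>The answer is read off register \<open>0\<close>: \<open>1\<close> for yes and \<open>0\<close> for no.\<close>

definition answers_within :: "program \<Rightarrow> bool list \<Rightarrow> bool \<Rightarrow> nat \<Rightarrow> bool" where
  "answers_within P w b T \<longleftrightarrow>
     (\<exists>t\<le>T. \<exists>pc R M. (step P ^^ t) (initial_config w) = (pc, R, M) \<and>
        halted P (pc, R, M) \<and> R 0 = of_bool b)"

text \<open>
  \<open>A\<close> is the set of admissible instances, encoded as words by \<open>enc\<close>. Nothing is required of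
  the program on words that do not encode an instance in \<open>A\<close>.
\<close>

definition solvable_in_poly_time ::
    "('i \<Rightarrow> bool list) \<Rightarrow> 'i set \<Rightarrow> ('i \<Rightarrow> bool) \<Rightarrow> bool" where
  "solvable_in_poly_time enc A yes \<longleftrightarrow>
     (\<exists>(P :: program) (p :: nat poly). \<forall>x\<in>A.
        answers_within P (enc x) (yes x) (poly p (length (enc x))))"


subsection \<open>Instances\<close>

text \<open>
  \<open>(n, E, U)\<close> is the graph with vertices \<open>0, \<dots>, n - 1\<close> and edge set \<open>E\<close>, with a vertex set \<open>U\<close>.
  It is encoded as \<open>n\<close> in unary, ended by a \<open>False\<close>, then the adjacency matrix row by row,
  then the characteristic vector of \<open>U\<close>.
\<close>

type_synonym ext_instance = "nat \<times> nat set set \<times> nat set"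

fun encode_instance :: "ext_instance \<Rightarrow> bool list" where
  "encode_instance (n, E, U) =
     replicate n True @ [False] @
     concat (map (\<lambda>i. map (\<lambda>j. {i, j} \<in> E) [0..<n]) [0..<n]) @
     map (\<lambda>i. i \<in> U) [0..<n]"

end

theory Submission
  imports Defs
begin

text \<open>
  A dominating set is minimal iff it is irredundant, that is, each member \<open>u\<close> has a private
  neighbour: a vertex whose closed neighbourhood meets the set in \<open>u\<close> only. Irredundance passes
  to subsets, so it is necessary for \<open>U\<close> to be extendable. In a split graph with clique \<open>C\<close>
  and independent set \<open>I\<close> it is also sufficient. If \<open>U\<close> is independent, any maximal
  independent superset works. Otherwise irredundance forces two members of \<open>U\<close> in \<open>C\<close> and no
  edge between \<open>U \<inter> C\<close> and \<open>U \<inter> I\<close>; then all private neighbours of \<open>U \<inter> C\<close> lie in \<open>I\<close>, and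
  \<open>U \<inter> C\<close> together with the vertices of \<open>I\<close> that it leaves undominated is a minimal dominating
  set. So no split partition need be computed: irredundance of \<open>U\<close> is tested by three nested
  loops.
\<close>

section \<open>Extensions in split graphs\<close>

definition irredundant :: "'a set \<Rightarrow> 'a set set \<Rightarrow> 'a set \<Rightarrow> bool" where
  "irredundant V E D \<longleftrightarrow> (\<forall>u\<in>D. \<exists>w\<in>V. {x\<in>D. x = w \<or> {x, w} \<in> E} = {u})"

lemma irredundant_subset:
  assumes "irredundant V E D" "U \<subseteq> D"
  shows "irredundant V E U"
  unfolding irredundant_def
proof
  fix u assume u: "u \<in> U"
  then obtain w where "w \<in> V" "{x\<in>D. x = w \<or> {x, w} \<in> E} = {u}"
    using assms unfolding irredundant_def by blast
  moreover from this have "{x\<in>U. x = w \<or> {x, w} \<in> E} = {u}"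
    using assms(2) u by blast
  ultimately show "\<exists>w\<in>V. {x\<in>U. x = w \<or> {x, w} \<in> E} = {u}" by blast
qed

text \<open>Removing \<open>u\<close> from \<open>D\<close> leaves some \<open>w\<close>
  undominated; as \<open>D\<close> dominates \<open>w\<close>, only \<open>u\<close> did so.
  Conversely, a proper subset of \<open>D\<close> misses some \<open>u\<close> and then fails to
  dominate the private neighbour of \<open>u\<close>.\<close>

lemma minimal_dominating_set_iff:
  "minimal_dominating_set V E D \<longleftrightarrow> dominating_set V E D \<and> irredundant V E D"
proof (intro iffI conjI)
  assume min: "minimal_dominating_set V E D"
  then show dom: "dominating_set V E D" by (simp add: minimal_dominating_set_def)
  show "irredundant V E D" unfolding irredundant_def
  proof
    fix u assume u: "u \<in> D"
    then have "\<not> dominating_set V E (D - {u})"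
      using min unfolding minimal_dominating_set_def by blast
    then obtain w where w: "w \<in> V" "w \<notin> D - {u}" "\<forall>x\<in>D - {u}. {x, w} \<notin> E"
      using dom unfolding dominating_set_def by blast
    moreover have "w \<in> D \<or> (\<exists>x\<in>D. {x, w} \<in> E)"
      using dom w(1) unfolding dominating_set_def by blast
    ultimately have "{x\<in>D. x = w \<or> {x, w} \<in> E} = {u}" using u by blast
    with w(1) show "\<exists>w\<in>V. {x\<in>D. x = w \<or> {x, w} \<in> E} = {u}" by blast
  qed
next
  assume *: "dominating_set V E D \<and> irredundant V E D"
  have "\<not> dominating_set V E D'" if D': "D' \<subset> D" for D'
  proof
    assume dom: "dominating_set V E D'"
    obtain u where u: "u \<in> D" "u \<notin> D'" using D' by blast
    then obtain w where w: "w \<in> V" "{x\<in>D. x = w \<or> {x, w} \<in> E} = {u}"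
      using * unfolding irredundant_def by blast
    have "w \<in> D' \<or> (\<exists>x\<in>D'. {x, w} \<in> E)"
      using dom w(1) unfolding dominating_set_def by blast
    then obtain x where "x \<in> D'" "x = w \<or> {x, w} \<in> E" by blast
    then have "x \<in> {x\<in>D. x = w \<or> {x, w} \<in> E}" using D' by blast
    then show False using w(2) u(2) \<open>x \<in> D'\<close> by simp
  qed
  then show "minimal_dominating_set V E D"
    using * unfolding minimal_dominating_set_def by blast
qed

text \<open>A vertex left undominated by a maximal independent set could be added to it, and every
  member is its own private neighbour.\<close>

lemma independent_set_extension:
  assumes "simple_graph V E" "U \<subseteq> V" "independent_set E U"
  shows "extension_dominating_set V E U"
proof -
  let ?S = "{D. D \<subseteq> V \<and> independent_set E D}"
  have V: "finite V" and loop: "\<And>v. {v} \<notin> E"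
    using assms(1) unfolding simple_graph_def by fastforce+
  have "finite ?S" using V by (auto intro: finite_subset[of _ "Pow V"])
  moreover have "U \<in> ?S" using assms(2,3) by simp
  ultimately obtain D where D: "D \<in> ?S" "U \<subseteq> D" and max: "\<forall>D'\<in>?S. D \<subseteq> D' \<longrightarrow> D = D'"
    by (rule finite_has_maximal2[THEN bexE]) (elim conjE)
  have "dominating_set V E D" unfolding dominating_set_def
  proof (intro conjI ballI)
    fix v assume v: "v \<in> V"
    show "v \<in> D \<or> (\<exists>u\<in>D. {u, v} \<in> E)"
    proof (rule ccontr)
      assume *: "\<not> ?thesis"
      then have "independent_set E (insert v D)"
        using D(1) loop unfolding independent_set_def by (auto simp: insert_commute)
      then have "insert v D = D" using max D(1) v by blast
      then show False using * by blast
    qed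
  qed (use D in blast)
  moreover have "irredundant V E D" unfolding irredundant_def
  proof
    fix u assume "u \<in> D"
    then have "u \<in> V" "{x\<in>D. x = u \<or> {x, u} \<in> E} = {u}"
      using D(1) unfolding independent_set_def by auto
    then show "\<exists>w\<in>V. {x\<in>D. x = w \<or> {x, w} \<in> E} = {u}" by blast
  qed
  ultimately show ?thesis
    using D(2) unfolding extension_dominating_set_def minimal_dominating_set_iff by blast
qed

lemma dependent_set_extension:
  assumes split: "split_graph V E" and U: "U \<subseteq> V" "irredundant V E U"
    and dep: "\<not> independent_set E U"
  shows "extension_dominating_set V E U"
proof -
  obtain C I where CI: "C \<union> I = V" "C \<inter> I = {}" "clique E C" "independent_set E I"
    using split unfolding split_graph_def by blast
  have loop: "{v} \<notin> E" for v
    using split unfolding split_graph_def simple_graph_def by fastforce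
  have no_I: "{x, y} \<notin> E" if "x \<in> I" "y \<in> I" for x y
    using CI(4) that unfolding independent_set_def by blast
  have in_C: "{x, y} \<in> E" if "x \<in> C" "y \<in> C" "x \<noteq> y" for x y
    using CI(3) that unfolding clique_def by blast
  \<comment> \<open>A private neighbour \<open>w\<close> of \<open>y\<close> is not dominated by
    \<open>x\<close>, which dominates all of \<open>C\<close>; so \<open>w\<close> lies in
    \<open>I\<close>, which forces \<open>w = y\<close>, against the edge.\<close>
  have no_CI: "{x, y} \<notin> E" if x: "x \<in> U \<inter> C" and y: "y \<in> U \<inter> I" for x y
  proof
    assume e: "{x, y} \<in> E"
    obtain w where w: "w \<in> V" "{z\<in>U. z = w \<or> {z, w} \<in> E} = {y}"
      using U(2) y unfolding irredundant_def by blast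
    have "x \<noteq> y" using x y CI(2) by blast
    then have x': "x \<noteq> w" "{x, w} \<notin> E" using w(2) x by blast+
    then have "w \<in> I" using in_C[of x w] x w(1) CI(1) by blast
    then have "y = w" using w(2) y no_I[of y w] by blast
    then show False using e x' by simp
  qed
  have "\<exists>a b. a \<in> U \<inter> C \<and> b \<in> U \<inter> C \<and> a \<noteq> b"
  proof -
    obtain a b where ab: "a \<in> U" "b \<in> U" "{a, b} \<in> E"
      using dep unfolding independent_set_def by blast
    then have "a \<in> C" "b \<in> C"
      using no_I[of a b] no_CI[of a b] no_CI[of b a] CI(1) U(1) by (auto simp: insert_commute)
    moreover have "a \<noteq> b" using ab(3) loop by auto
    ultimately show ?thesis using ab by blast
  qed
  then obtain a b where ab: "a \<in> U \<inter> C" "b \<in> U \<inter> C" "a \<noteq> b" by blast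
  define Y where "Y = {y\<in>I. \<forall>x\<in>U \<inter> C. {x, y} \<notin> E}"
  define D where "D = U \<inter> C \<union> Y"
  have "U \<subseteq> D" using no_CI U(1) CI(1) unfolding D_def Y_def by blast
  moreover have "dominating_set V E D" unfolding dominating_set_def
  proof (intro conjI ballI)
    show "D \<subseteq> V" using CI(1) unfolding D_def Y_def by blast
    fix v assume "v \<in> V"
    then consider "v \<in> C" | "v \<in> I" using CI(1) by blast
    then show "v \<in> D \<or> (\<exists>u\<in>D. {u, v} \<in> E)"
    proof cases
      case 1
      then show ?thesis using in_C[of a v] ab(1) unfolding D_def by blast
    next
      case 2
      then show ?thesis unfolding D_def Y_def by blast
    qed
  qed
  moreover have "irredundant V E D" unfolding irredundant_def
  proof
    fix u assume "u \<in> D"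
    then consider "u \<in> U \<inter> C" | "u \<in> Y" unfolding D_def by blast
    then show "\<exists>w\<in>V. {x\<in>D. x = w \<or> {x, w} \<in> E} = {u}"
    proof cases
      case 1
      then obtain w where w: "w \<in> V" "{z\<in>U. z = w \<or> {z, w} \<in> E} = {u}"
        using U(2) unfolding irredundant_def by blast
      \<comment> \<open>In \<open>C\<close>, \<open>w\<close> would be dominated by both
        \<open>a\<close> and \<open>b\<close>, but only \<open>u\<close> dominates it within
        \<open>U\<close>.\<close>
      have "w \<notin> C"
      proof
        assume "w \<in> C"
        then have "a \<in> {u}" "b \<in> {u}"
          unfolding w(2)[symmetric] using in_C[of a w] in_C[of b w] ab by blast+
        then show False using ab(3) by blast
      qed
      then have "w \<in> I" using w(1) CI(1) by blast
      moreover have "{u, w} \<in> E" using equalityD2[OF w(2)] 1 \<open>w \<notin> C\<close> by blast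
      \<comment> \<open>\<open>Y\<close> adds no dominator of \<open>w\<close>: its members are not
        adjacent to \<open>w \<in> I\<close>, and \<open>w\<close> itself is outside
        \<open>Y\<close>, being adjacent to \<open>u\<close>.\<close>
      ultimately have "{x\<in>D. x = w \<or> {x, w} \<in> E} = {u}"
        using w(2) 1 no_I[of _ w] \<open>w \<notin> C\<close> unfolding D_def Y_def by blast
      with w(1) show ?thesis by blast
    next
      case 2
      then have "{x\<in>D. x = u \<or> {x, u} \<in> E} = {u}"
        using no_I[of _ u] unfolding D_def Y_def by blast
      then show ?thesis using 2 CI(1) unfolding Y_def by blast
    qed
  qed
  ultimately show ?thesis
    unfolding extension_dominating_set_def minimal_dominating_set_iff by blast
qed

theorem split_graph_extension_iff_irredundant:
  assumes "split_graph V E" "U \<subseteq> V"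
  shows "extension_dominating_set V E U \<longleftrightarrow> irredundant V E U"
proof
  assume "extension_dominating_set V E U"
  then show "irredundant V E U"
    unfolding extension_dominating_set_def minimal_dominating_set_iff
    using irredundant_subset by blast
next
  assume "irredundant V E U"
  then show "extension_dominating_set V E U"
    using assms independent_set_extension dependent_set_extension
    unfolding split_graph_def by metis
qed

section \<open>The machine\<close>

definition reaches :: "program \<Rightarrow> nat \<Rightarrow> config \<Rightarrow> config \<Rightarrow> bool" where
  "reaches P T c c' \<longleftrightarrow> (\<exists>t\<le>T. (step P ^^ t) c = c')"

lemma reaches_refl: "reaches P T c c"
  unfolding reaches_def by (intro exI[of _ 0]) simp

lemma reaches_trans:
  assumes "reaches P T c c'" "reaches P T' c' c''"
  shows "reaches P (T + T') c c''"
proof -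
  obtain t t' where "t \<le> T" "(step P ^^ t) c = c'" "t' \<le> T'" "(step P ^^ t') c' = c''"
    using assms unfolding reaches_def by blast
  then have "t' + t \<le> T + T'" "(step P ^^ (t' + t)) c = c''" by (simp_all add: funpow_add)
  then show ?thesis unfolding reaches_def by blast
qed

text \<open>A Hoare triple with a time bound between two program points. The memory is a fixed
  parameter because the program never stores.\<close>

definition leads :: "program \<Rightarrow> (nat \<Rightarrow> nat) \<Rightarrow> nat \<Rightarrow> nat \<Rightarrow> ((nat \<Rightarrow> nat) \<Rightarrow> bool) \<Rightarrow>
    nat \<Rightarrow> ((nat \<Rightarrow> nat) \<Rightarrow> bool) \<Rightarrow> bool" where
  "leads P M T pc Q pc' Q' \<longleftrightarrow>
     (\<forall>R. Q R \<longrightarrow> (\<exists>R'. Q' R' \<and> reaches P T (pc, R, M) (pc', R', M)))"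

lemma leads_trans:
  assumes "leads P M T pc Q pc' Q'" "leads P M T' pc' Q' pc'' Q''"
  shows "leads P M (T + T') pc Q pc'' Q''"
  unfolding leads_def
proof (intro allI impI)
  fix R assume "Q R"
  then obtain R' where R': "Q' R'" "reaches P T (pc, R, M) (pc', R', M)"
    using assms(1) unfolding leads_def by blast
  then obtain R'' where R'': "Q'' R''" "reaches P T' (pc', R', M) (pc'', R'', M)"
    using assms(2) unfolding leads_def by blast
  show "\<exists>R''. Q'' R'' \<and> reaches P (T + T') (pc, R, M) (pc'', R'', M)"
    using R''(1) reaches_trans[OF R'(2) R''(2)] by blast
qed

text \<open>\<open>Q\<close> is indexed by the number of completed rounds. In the uses below a round
  includes its successful loop test; the final, failing test is charged to the segment after the
  loop.\<close>

lemma leads_loop: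
  assumes "\<And>k. k < n \<Longrightarrow> leads P M T pc (Q k) pc (Q (Suc k))"
  shows "leads P M (n * T) pc (Q 0) pc (Q n)"
  using assms
proof (induction n)
  case 0
  then show ?case unfolding leads_def using reaches_refl by fastforce
next
  case (Suc n)
  then have "leads P M (n * T + T) pc (Q 0) pc (Q (Suc n))" by (intro leads_trans) auto
  then show ?case by (simp add: add.commute)
qed

lemma leadsI:
  assumes "\<And>R. Q R \<Longrightarrow>
    (case (step P ^^ T) (pc, R, M) of (pc1, R1, M1) \<Rightarrow> pc1 = pc' \<and> M1 = M \<and> Q' R1)"
  shows "leads P M T pc Q pc' Q'"
  unfolding leads_def
proof (intro allI impI)
  fix R assume "Q R"
  then obtain R' where "(step P ^^ T) (pc, R, M) = (pc', R', M)" "Q' R'"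
    using assms[of R] by (auto split: prod.splits)
  then show "\<exists>R'. Q' R' \<and> reaches P T (pc, R, M) (pc', R', M)"
    unfolding reaches_def by blast
qed

text \<open>Exposes the innermost application, so that the simplifier runs the machine forward from
  a concrete program counter.\<close>

lemma funpow_numeral_apply: "(f ^^ numeral k) x = (f ^^ pred_numeral k) (f x)"
  by (simp add: numeral_eq_Suc funpow_swap1)

text \<open>
  Register 3 receives \<open>n\<close>, the number of leading ones of the input. Registers 5, 6 and 7 run
  over \<open>u\<close>, \<open>w\<close> and \<open>x\<close>; register 4 holds the address of the characteristic vector of \<open>U\<close>,
  and register 8 walks through the adjacency matrix. Register 2 stays \<open>0\<close>, so that jumps on it
  are unconditional. Apart from these, the loop bodies are free of branches: conjunction,
  equality and negation of truth values are expressed by truncated subtraction. Comments inside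
  the program give the addresses of jump targets.
\<close>

definition irredundance_program :: program where
  "irredundance_program = [
     Const 1 1,
     Load 4 3, JumpZero 4 5, Add 3 3 1, JumpZero 2 1,
     Sub 4 0 3,
     \<comment> \<open>6\<close> Sub 10 3 5, JumpZero 10 48, Const 6 0, Add 8 3 1, Const 14 0,
     \<comment> \<open>11\<close> Sub 10 3 6, JumpZero 10 42, Const 7 0, Const 13 0,
     \<comment> \<open>15\<close> Sub 10 3 7, JumpZero 10 38,
     Load 10 8, Sub 11 7 6, Sub 12 6 7, Add 11 11 12, Sub 11 1 11, Add 10 10 11,
     Add 11 4 7, Load 11 11, Add 10 10 11, Sub 10 10 1,
     Sub 11 7 5, Sub 12 5 7, Add 11 11 12, Sub 11 1 11,
     Sub 12 10 11, Sub 11 11 10, Add 11 11 12, Add 13 13 11,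
     Add 7 7 1, Add 8 8 1, JumpZero 2 15,
     \<comment> \<open>38\<close> Sub 13 1 13, Add 14 14 13, Add 6 6 1, JumpZero 2 11,
     \<comment> \<open>42\<close> Add 11 4 5, Load 11 11, Sub 11 11 14, Add 15 15 11, Add 5 5 1, JumpZero 2 6,
     \<comment> \<open>48\<close> Sub 0 1 15]"

lemmas run_simps =
  funpow_numeral_apply step_def halted_def irredundance_program_def numeral_2_eq_2[symmetric]

section \<open>The numbers accumulated by the three loops\<close>

definition eq_bit :: "nat \<Rightarrow> nat \<Rightarrow> nat" where
  "eq_bit i j = 1 - ((i - j) + (j - i))"

lemma eq_bit_eq: "eq_bit i j = of_bool (i = j)"
  by (auto simp: eq_bit_def)

text \<open>Whether \<open>x\<close> is a member of \<open>U\<close> in the closed neighbourhood of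
  \<open>w\<close>. Subtracting 1 from a sum of two bits is conjunction; the first two summands act
  as one bit when the matrix has a zero diagonal.\<close>

definition hit_bit :: "(nat \<Rightarrow> nat) \<Rightarrow> nat \<Rightarrow> nat \<Rightarrow> nat \<Rightarrow> nat \<Rightarrow> nat" where
  "hit_bit M n b w x = M (Suc n + w * n + x) + eq_bit x w + M (b + x) - 1"

text \<open>Exclusive or of two bits: \<open>w\<close> is a private neighbour of \<open>u\<close>
  iff no \<open>x\<close> gives a mismatch.\<close>

definition mismatch :: "(nat \<Rightarrow> nat) \<Rightarrow> nat \<Rightarrow> nat \<Rightarrow> nat \<Rightarrow> nat \<Rightarrow> nat \<Rightarrow> nat" where
  "mismatch M n b u w x =
     (eq_bit x u - hit_bit M n b w x) + (hit_bit M n b w x - eq_bit x u)"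

definition private_count :: "(nat \<Rightarrow> nat) \<Rightarrow> nat \<Rightarrow> nat \<Rightarrow> nat \<Rightarrow> nat \<Rightarrow> nat" where
  "private_count M n b u m = (\<Sum>w<m. 1 - (\<Sum>x<n. mismatch M n b u w x))"

text \<open>When \<open>M (b + u)\<close> is the bit of \<open>u \<in> U\<close>, truncation makes a
  term 1 exactly for a member of \<open>U\<close> without private neighbour.\<close>

definition redundant_count :: "(nat \<Rightarrow> nat) \<Rightarrow> nat \<Rightarrow> nat \<Rightarrow> nat \<Rightarrow> nat" where
  "redundant_count M n b m = (\<Sum>u<m. M (b + u) - private_count M n b u n)"

definition outer_inv :: "(nat \<Rightarrow> nat) \<Rightarrow> nat \<Rightarrow> nat \<Rightarrow> nat \<Rightarrow> (nat \<Rightarrow> nat) \<Rightarrow> bool" where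
  "outer_inv M n b u R \<longleftrightarrow> R 1 = 1 \<and> R 2 = 0 \<and> R 3 = n \<and> R 4 = b \<and> R 5 = u \<and>
     R 15 = redundant_count M n b u"

definition middle_inv :: "(nat \<Rightarrow> nat) \<Rightarrow> nat \<Rightarrow> nat \<Rightarrow> nat \<Rightarrow> nat \<Rightarrow> (nat \<Rightarrow> nat) \<Rightarrow> bool" where
  "middle_inv M n b u w R \<longleftrightarrow> outer_inv M n b u R \<and> R 6 = w \<and>
     R 8 = Suc n + w * n \<and> R 14 = private_count M n b u w"

text \<open>\<open>middle_inv\<close> cannot be reused here, as register 8 has already moved on by
  \<open>x\<close> cells.\<close>

definition inner_inv ::
    "(nat \<Rightarrow> nat) \<Rightarrow> nat \<Rightarrow> nat \<Rightarrow> nat \<Rightarrow> nat \<Rightarrow> nat \<Rightarrow> (nat \<Rightarrow> nat) \<Rightarrow> bool" where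
  "inner_inv M n b u w x R \<longleftrightarrow> outer_inv M n b u R \<and> R 6 = w \<and>
     R 8 = Suc n + w * n + x \<and> R 14 = private_count M n b u w \<and>
     R 7 = x \<and> R 13 = (\<Sum>x<x. mismatch M n b u w x)"

section \<open>Verification of the program, from the inner loop outwards\<close>

lemma inner_loop_body:
  assumes "x < n"
  shows "leads irredundance_program M 23 15 (inner_inv M n b u w x)
           15 (inner_inv M n b u w (Suc x))"
proof -
  let ?P = irredundance_program and ?Q = "inner_inv M n b u w x"
  have "leads ?P M 7 15 ?Q
      22 (\<lambda>R. ?Q R \<and> R 10 = M (Suc n + w * n + x) \<and> R 11 = eq_bit x w)"
    by (rule leadsI)
      (use assms in \<open>simp add: run_simps inner_inv_def outer_inv_def eq_bit_def\<close>)
  moreover have "leads ?P M 5 22 (\<lambda>R. ?Q R \<and> R 10 = M (Suc n + w * n + x) \<and> R 11 = eq_bit x w)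
      27 (\<lambda>R. ?Q R \<and> R 10 = hit_bit M n b w x)"
    by (rule leadsI) (simp add: run_simps inner_inv_def outer_inv_def hit_bit_def)
  moreover have "leads ?P M 4 27 (\<lambda>R. ?Q R \<and> R 10 = hit_bit M n b w x)
      31 (\<lambda>R. ?Q R \<and> R 10 = hit_bit M n b w x \<and> R 11 = eq_bit x u)"
    by (rule leadsI) (simp add: run_simps inner_inv_def outer_inv_def eq_bit_def)
  moreover have "leads ?P M 7 31 (\<lambda>R. ?Q R \<and> R 10 = hit_bit M n b w x \<and> R 11 = eq_bit x u)
      15 (inner_inv M n b u w (Suc x))"
    by (rule leadsI) (simp add: run_simps inner_inv_def outer_inv_def mismatch_def)
  ultimately have "leads ?P M (7 + 5 + 4 + 7) 15 ?Q 15 (inner_inv M n b u w (Suc x))"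
    by (intro leads_trans)
  then show ?thesis by simp
qed

lemma middle_loop_body:
  assumes "w < n"
  shows "leads irredundance_program M (10 + n * 23) 11 (middle_inv M n b u w)
           11 (middle_inv M n b u (Suc w))"
proof -
  have "leads irredundance_program M 4 11 (middle_inv M n b u w) 15 (inner_inv M n b u w 0)"
    by (rule leadsI) (use assms in \<open>simp add: run_simps inner_inv_def middle_inv_def outer_inv_def\<close>)
  moreover have "leads irredundance_program M (n * 23) 15 (inner_inv M n b u w 0)
      15 (inner_inv M n b u w n)"
    by (intro leads_loop inner_loop_body)
  \<comment> \<open>After \<open>n\<close> cells register 8 stands at the start of the next row, so
    row addresses are found without multiplication.\<close>
  moreover have "leads irredundance_program M 6 15 (inner_inv M n b u w n)
      11 (middle_inv M n b u (Suc w))"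
    by (rule leadsI)
      (simp add: run_simps inner_inv_def middle_inv_def outer_inv_def private_count_def)
  ultimately have "leads irredundance_program M (4 + n * 23 + 6) 11 (middle_inv M n b u w)
      11 (middle_inv M n b u (Suc w))"
    by (intro leads_trans)
  then show ?thesis by (simp add: algebra_simps)
qed

lemma outer_loop_body:
  assumes "u < n"
  shows "leads irredundance_program M (13 + n * (10 + n * 23)) 6 (outer_inv M n b u)
           6 (outer_inv M n b (Suc u))"
proof -
  have "leads irredundance_program M 5 6 (outer_inv M n b u) 11 (middle_inv M n b u 0)"
    by (rule leadsI)
      (use assms in \<open>simp add: run_simps middle_inv_def outer_inv_def private_count_def\<close>)
  moreover have "leads irredundance_program M (n * (10 + n * 23)) 11 (middle_inv M n b u 0)
      11 (middle_inv M n b u n)"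
    by (intro leads_loop middle_loop_body)
  moreover have "leads irredundance_program M 8 11 (middle_inv M n b u n)
      6 (outer_inv M n b (Suc u))"
    by (rule leadsI) (simp add: run_simps middle_inv_def outer_inv_def redundant_count_def)
  ultimately have "leads irredundance_program M (5 + n * (10 + n * 23) + 8) 6 (outer_inv M n b u)
      6 (outer_inv M n b (Suc u))"
    by (intro leads_trans)
  then show ?thesis by (simp add: algebra_simps)
qed

definition scan_inv :: "nat \<Rightarrow> nat \<Rightarrow> (nat \<Rightarrow> nat) \<Rightarrow> bool" where
  "scan_inv l k R \<longleftrightarrow> R 0 = l \<and> R 1 = 1 \<and> R 2 = 0 \<and> R 3 = k \<and> R 5 = 0 \<and> R 15 = 0"

lemma irredundance_program_correct:
  assumes ones: "\<And>i. i < n \<Longrightarrow> M i \<noteq> 0" and zero: "M n = 0"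
  shows "leads irredundance_program M (7 + n * 4 + n * (13 + n * (10 + n * 23)))
           0 (\<lambda>R. R = (\<lambda>_. 0)(0 := l)) 49 (\<lambda>R. R 0 = 1 - redundant_count M n (l - n) n)"
proof -
  let ?P = irredundance_program and ?b = "l - n"
  have "leads ?P M 1 0 (\<lambda>R. R = (\<lambda>_. 0)(0 := l)) 1 (scan_inv l 0)"
    by (rule leadsI) (simp add: run_simps scan_inv_def)
  moreover have "leads ?P M (n * 4) 1 (scan_inv l 0) 1 (scan_inv l n)"
    by (rule leads_loop, rule leadsI) (use ones in \<open>simp add: run_simps scan_inv_def\<close>)
  \<comment> \<open>Register 4 becomes \<open>l - n\<close>, because the vector of \<open>U\<close>
    fills the last \<open>n\<close> letters.\<close>
  moreover have "leads ?P M 3 1 (scan_inv l n) 6 (outer_inv M n ?b 0)"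
    by (rule leadsI)
      (use zero in \<open>simp add: run_simps scan_inv_def outer_inv_def redundant_count_def\<close>)
  moreover have "leads ?P M (n * (13 + n * (10 + n * 23))) 6 (outer_inv M n ?b 0)
      6 (outer_inv M n ?b n)"
    by (intro leads_loop outer_loop_body)
  moreover have "leads ?P M 3 6 (outer_inv M n ?b n)
      49 (\<lambda>R. R 0 = 1 - redundant_count M n ?b n)"
    by (rule leadsI) (simp add: run_simps outer_inv_def)
  ultimately have "leads ?P M (1 + n * 4 + 3 + n * (13 + n * (10 + n * 23)) + 3)
      0 (\<lambda>R. R = (\<lambda>_. 0)(0 := l)) 49 (\<lambda>R. R 0 = 1 - redundant_count M n ?b n)"
    by (intro leads_trans)
  then show ?thesis by (simp add: algebra_simps)
qed

section \<open>Encoded instances\<close>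

lemma length_concat_rows:
  "length (concat (map (\<lambda>i. map (f i) [0..<n]) [0..<m])) = m * n"
  by (induction m) simp_all

lemma nth_concat_rows:
  assumes "i < m" "j < n"
  shows "concat (map (\<lambda>i. map (f i) [0..<n]) [0..<m]) ! (i * n + j) = f i j"
  using assms(1)
proof (induction m)
  case (Suc m)
  show ?case
  proof (cases "i = m")
    case True
    then show ?thesis using assms(2) by (simp add: nth_append length_concat_rows)
  next
    case False
    then have "i < m" using Suc.prems by simp
    then have "Suc i * n \<le> m * n" by (intro mult_right_mono) auto
    then have "i * n + j < m * n" using assms(2) by simp
    then show ?thesis using Suc.IH[OF \<open>i < m\<close>] by (simp add: nth_append length_concat_rows)
  qed
qed simp

lemma length_encode_instance: "length (encode_instance (n, E, U)) = Suc n + n * n + n"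
  by (simp add: length_concat_rows)

lemma encode_instance_nth:
  fixes n i j :: nat and E :: "nat set set" and U :: "nat set"
  defines "w \<equiv> encode_instance (n, E, U)"
  shows "i < n \<Longrightarrow> w ! i"
    and "\<not> w ! n"
    and "i < n \<Longrightarrow> j < n \<Longrightarrow> w ! (Suc n + i * n + j) \<longleftrightarrow> {i, j} \<in> E"
    and "i < n \<Longrightarrow> w ! (Suc n + n * n + i) \<longleftrightarrow> i \<in> U"
proof -
  let ?A = "concat (map (\<lambda>i. map (\<lambda>j. {i, j} \<in> E) [0..<n]) [0..<n])"
  have w: "w = (replicate n True @ [False]) @ ?A @ map (\<lambda>i. i \<in> U) [0..<n]"
    by (simp add: w_def)
  have pre: "w ! (Suc n + k) = (?A @ map (\<lambda>i. i \<in> U) [0..<n]) ! k" for k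
    unfolding w by (subst nth_append) simp
  show "i < n \<Longrightarrow> w ! i" "\<not> w ! n" unfolding w by (simp_all add: nth_append)
  show "w ! (Suc n + i * n + j) \<longleftrightarrow> {i, j} \<in> E" if ij: "i < n" "j < n"
  proof -
    have "Suc i * n \<le> n * n" using ij by (intro mult_right_mono) auto
    then have "i * n + j < n * n" using ij by simp
    then show ?thesis
      using pre[of "i * n + j"] nth_concat_rows[OF ij, of "\<lambda>i j. {i, j} \<in> E"]
      by (simp add: nth_append length_concat_rows add.assoc)
  qed
  show "w ! (Suc n + n * n + i) \<longleftrightarrow> i \<in> U" if "i < n"
    using pre[of "n * n + i"] that by (simp add: nth_append length_concat_rows add.assoc)
qed

text \<open>The diagonal entries must be 0: for \<open>x = w\<close> outside \<open>U\<close>, an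
  entry 1 would make \<open>hit_bit\<close> equal to 1.\<close>

lemma mismatch_eq_0_iff:
  assumes "M (Suc n + w * n + x) = of_bool (w \<noteq> x \<and> {w, x} \<in> E)" "M (b + x) = of_bool (x \<in> U)"
  shows "mismatch M n b u w x = 0 \<longleftrightarrow> ((x \<in> U \<and> (x = w \<or> {x, w} \<in> E)) \<longleftrightarrow> x = u)"
  unfolding mismatch_def hit_bit_def eq_bit_eq assms insert_commute[of w x]
  by (cases "x = w"; cases "x = u"; cases "x \<in> U"; cases "{x, w} \<in> E") auto

text \<open>A sum of naturals vanishes iff all its terms do; used on the three nested sums, this
  yields the quantifiers over \<open>u\<close>, \<open>w\<close> and \<open>x\<close>.\<close>

lemma redundant_count_eq_0_iff:
  assumes A: "\<And>w x. w < n \<Longrightarrow> x < n \<Longrightarrow> M (Suc n + w * n + x) = of_bool (w \<noteq> x \<and> {w, x} \<in> E)"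
    and M_U: "\<And>x. x < n \<Longrightarrow> M (b + x) = of_bool (x \<in> U)"
    and U: "U \<subseteq> {..<n}"
  shows "redundant_count M n b n = 0 \<longleftrightarrow> irredundant {..<n} E U"
proof -
  have mis: "(\<Sum>x<n. mismatch M n b u w x) = 0 \<longleftrightarrow> {x\<in>U. x = w \<or> {x, w} \<in> E} = {u}"
    if "u < n" "w < n" for u w
  proof -
    have "(\<Sum>x<n. mismatch M n b u w x) = 0 \<longleftrightarrow>
        (\<forall>x<n. (x \<in> U \<and> (x = w \<or> {x, w} \<in> E)) \<longleftrightarrow> x = u)"
      using mismatch_eq_0_iff[OF A M_U] that by auto
    also have "\<dots> \<longleftrightarrow> {x\<in>U. x = w \<or> {x, w} \<in> E} = {u}"
      using U that by (auto simp: set_eq_iff)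
    finally show ?thesis .
  qed
  have priv: "private_count M n b u n \<noteq> 0 \<longleftrightarrow> (\<exists>w\<in>{..<n}. {x\<in>U. x = w \<or> {x, w} \<in> E} = {u})"
    if "u < n" for u
  proof -
    have "private_count M n b u n = 0 \<longleftrightarrow> (\<forall>w<n. (\<Sum>x<n. mismatch M n b u w x) \<noteq> 0)"
      unfolding private_count_def
      by (subst sum_eq_0_iff) (auto simp: Suc_le_eq simp del: sum_eq_0_iff)
    then show ?thesis using mis[OF that] by (auto simp del: sum_eq_0_iff)
  qed
  have "redundant_count M n b n = 0 \<longleftrightarrow> (\<forall>u\<in>U. private_count M n b u n \<noteq> 0)"
  proof -
    have "redundant_count M n b n = 0 \<longleftrightarrow> (\<forall>u<n. M (b + u) \<le> private_count M n b u n)"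
      by (auto simp: redundant_count_def)
    also have "\<dots> \<longleftrightarrow> (\<forall>u<n. u \<in> U \<longrightarrow> private_count M n b u n \<noteq> 0)"
      using M_U by (auto simp: Suc_le_eq)
    finally show ?thesis using U by auto
  qed
  also have "\<dots> \<longleftrightarrow> irredundant {..<n} E U"
    unfolding irredundant_def using priv U by (intro ball_cong) auto
  finally show ?thesis .
qed

theorem theorem22:
  "solvable_in_poly_time encode_instance
     {(n, E, U). split_graph {..<n} E \<and> U \<subseteq> {..<n}}
     (\<lambda>(n, E, U). extension_dominating_set {..<n} E U)"
proof -
  \<comment> \<open>The running time \<open>?T\<close> below, expanded in powers of
    \<open>n\<close>; it is then bounded by monotonicity, with the word length in place of
    \<open>n\<close>.\<close>
  define p :: "nat poly" where "p = [:7, 17, 10, 23:]"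
  have "answers_within irredundance_program (encode_instance (n, E, U))
      (extension_dominating_set {..<n} E U) (poly p (length (encode_instance (n, E, U))))"
    if split: "split_graph {..<n} E" and U: "U \<subseteq> {..<n}" for n E U
  proof -
    define w where "w = encode_instance (n, E, U)"
    define M :: "nat \<Rightarrow> nat" where "M = (\<lambda>i. if i < length w then of_bool (w ! i) else 0)"
    let ?T = "7 + n * 4 + n * (13 + n * (10 + n * 23))" and ?b = "length w - n"
    have len: "length w = Suc n + n * n + n" unfolding w_def by (rule length_encode_instance)
    note nth = encode_instance_nth[where n = n and E = E and U = U, folded w_def]
    have loop: "{v} \<notin> E" for v
      using split unfolding split_graph_def simple_graph_def by fastforce
    have "M (Suc n + i * n + j) = of_bool (i \<noteq> j \<and> {i, j} \<in> E)" if "i < n" "j < n" for i j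
    proof -
      have "Suc i * n \<le> n * n" using that by (intro mult_right_mono) auto
      then have "Suc n + i * n + j < length w" using that by (simp add: len)
      then show ?thesis using nth(3)[OF that] loop by (auto simp: M_def)
    qed
    moreover have "M (?b + i) = of_bool (i \<in> U)" if "i < n" for i
      using nth(4)[OF that] that by (simp add: M_def len add.commute add.left_commute)
    ultimately have "redundant_count M n ?b n = 0 \<longleftrightarrow> irredundant {..<n} E U"
      using U by (rule redundant_count_eq_0_iff)
    then have ans: "1 - redundant_count M n ?b n = of_bool (extension_dominating_set {..<n} E U)"
      using split_graph_extension_iff_irredundant[OF split U] by auto
    have "leads irredundance_program M ?T 0 (\<lambda>R. R = (\<lambda>_. 0)(0 := length w))
        49 (\<lambda>R. R 0 = 1 - redundant_count M n ?b n)"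
      by (rule irredundance_program_correct) (use nth(1,2) len in \<open>simp_all add: M_def\<close>)
    then obtain R where R: "R 0 = 1 - redundant_count M n ?b n"
        "reaches irredundance_program ?T (initial_config w) (49, R, M)"
      unfolding leads_def initial_config_def M_def by blast
    have "n \<le> length w" by (simp add: len)
    then have "n * 23 \<le> length w * 23" by simp
    then have "n * (10 + n * 23) \<le> length w * (10 + length w * 23)"
      using \<open>n \<le> length w\<close> by (intro mult_le_mono) auto
    then have "n * (13 + n * (10 + n * 23)) \<le> length w * (13 + length w * (10 + length w * 23))"
      using \<open>n \<le> length w\<close> by (intro mult_le_mono) auto
    then have "?T \<le> poly p (length w)"
      using \<open>n \<le> length w\<close> by (simp add: p_def algebra_simps)
    then obtain t where "t \<le> poly p (length w)"
        "(step irredundance_program ^^ t) (initial_config w) = (49, R, M)"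
      using R(2) unfolding reaches_def by (meson le_trans)
    moreover have "halted irredundance_program (49, R, M)"
      by (simp add: halted_def irredundance_program_def)
    ultimately show ?thesis
      using R(1) ans unfolding answers_within_def w_def[symmetric] by metis
  qed
  then show ?thesis
    unfolding solvable_in_poly_time_def
    by (intro exI[of _ irredundance_program] exI[of _ p]) (auto simp del: encode_instance.simps)
qed

end
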